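(* Let $\mathbb F\in\{\mathbb R,\mathbb C\}$ and let $T:\mathcal T_n\to\mathcal T_n$ be an $\mathbb F$-linear map on the space $\mathcal T_n$ of $n\times n$ Toeplitz matrices over $\mathbb F$. Then $T$ preserves the rank of matrices, i.e. $\operatorname{rank}T(A)=\operatorname{rank}A$ for all $A\in\mathcal T_n$, if and only if there are nonzero $\gamma,r\in\mathbb F$ such that $T$ has the form $A\mapsto MAN$ with $M=\gamma F_nN^\top F_n$ and $N$ of one of the following forms: (1) $N=V_n(\alpha)D_n(r)$ for some $\alpha\in\mathbb F$; (2) $N=V_n(\alpha)F_nD_n(r)$ for some $\alpha\in\mathbb F$; (3) $N=W_n(\alpha,\beta)D_n(r)$ for some $\alpha,\beta\in\mathbb F$ with $\alpha\neq\beta$.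
   Context: A matrix $A\in M_n(\mathbb F)$ is Toeplitz if $A=[a_{i-j}]_{i,j=1}^n$ for some $a_{1-n},\dots,a_{n-1}\in\mathbb F$. $\mathbf e_1$ is the first column of $I_n$; $Z_n$ is the $n\times n$ lower shift matrix (ones on the first subdiagonal, zeros elsewhere); $\mathcal J_\alpha=\alpha I_n+Z_n$. $F_n$ is the $n\times n$ anti-diagonal permutation matrix (ones on the anti-diagonal, zeros elsewhere). $D_n(r)=\mathrm{diag}(1,r,\dots,r^{n-1})$. $V_n(\alpha)=[\mathbf e_1\ \mathcal J_\alpha\mathbf e_1\ \cdots\ \mathcal J_\alpha^{n-1}\mathbf e_1]$, i.e. the upper triangular matrix with $(i,j)$ entry $\binom{j-1}{i-1}\alpha^{j-i}$ for $i\le j$ (with $0^0=1$). $W_n(\alpha,\beta)$ is the $n\times n$ matrix whose $j$-th column is $\mathcal J_\beta^{n-j}\mathcal J_\alpha^{j-1}\mathbf e_1$, $j=1,\dots,n$. *)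

theory Defs
  imports Complex_Main "Jordan_Normal_Form.DL_Rank"
begin

text \<open>
  Matrices and vectors are indexed from 0, so the index \<open>i\<close> below is the index
  \<open>i + 1\<close> of the usual convention.
\<close>

definition toeplitz_space :: "nat \<Rightarrow> 'a::field mat set" where
  "toeplitz_space n =
     {A. \<exists>a :: int \<Rightarrow> 'a. A = mat n n (\<lambda>(i, j). a (int i - int j))}"

definition lower_shift :: "nat \<Rightarrow> 'a::field mat" where
  "lower_shift n = mat n n (\<lambda>(i, j). if i = Suc j then 1 else 0)"

definition jordan_lower :: "nat \<Rightarrow> 'a::field \<Rightarrow> 'a mat" where
  "jordan_lower n \<alpha> = \<alpha> \<cdot>\<^sub>m 1\<^sub>m n + lower_shift n"

text \<open>\<open>i + j + 1 = n\<close> is the anti-diagonal in 0-based indices.\<close>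

definition flip_mat :: "nat \<Rightarrow> 'a::field mat" where
  "flip_mat n = mat n n (\<lambda>(i, j). if i + j + 1 = n then 1 else 0)"

definition geom_diag :: "nat \<Rightarrow> 'a::field \<Rightarrow> 'a mat" where
  "geom_diag n r = mat_diag n (\<lambda>i. r ^ i)"

definition V_mat :: "nat \<Rightarrow> 'a::field \<Rightarrow> 'a mat" where
  "V_mat n \<alpha> =
     mat_of_cols n (map (\<lambda>j. (jordan_lower n \<alpha> ^\<^sub>m j) *\<^sub>v unit_vec n 0) [0..<n])"

text \<open>The exponents \<open>n - j\<close> and \<open>j - 1\<close> of the 1-based column \<open>j\<close>
  become \<open>n - 1 - j\<close> and \<open>j\<close>.\<close>

definition W_mat :: "nat \<Rightarrow> 'a::field \<Rightarrow> 'a \<Rightarrow> 'a mat" where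
  "W_mat n \<alpha> \<beta> =
     mat_of_cols n
       (map (\<lambda>j. (jordan_lower n \<beta> ^\<^sub>m (n - 1 - j) * jordan_lower n \<alpha> ^\<^sub>m j)
                 *\<^sub>v unit_vec n 0) [0..<n])"

text \<open>Maps are total functions on \<^typ>\<open>'a mat\<close>; only their values on
  the Toeplitz space matter here and in the predicates that follow.\<close>

definition toeplitz_linear_map :: "nat \<Rightarrow> ('a::field mat \<Rightarrow> 'a mat) \<Rightarrow> bool" where
  "toeplitz_linear_map n T \<longleftrightarrow>
     (\<forall>A \<in> toeplitz_space n. T A \<in> toeplitz_space n) \<and>
     (\<forall>A \<in> toeplitz_space n. \<forall>B \<in> toeplitz_space n. T (A + B) = T A + T B) \<and>
     (\<forall>c. \<forall>A \<in> toeplitz_space n. T (c \<cdot>\<^sub>m A) = c \<cdot>\<^sub>m T A)"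

definition preserves_rank :: "nat \<Rightarrow> ('a::field mat \<Rightarrow> 'a mat) \<Rightarrow> bool" where
  "preserves_rank n T \<longleftrightarrow>
     (\<forall>A \<in> toeplitz_space n. vec_space.rank n (T A) = vec_space.rank n A)"

definition preserver_form :: "nat \<Rightarrow> ('a::field mat \<Rightarrow> 'a mat) \<Rightarrow> bool" where
  "preserver_form n T \<longleftrightarrow>
     (\<exists>\<gamma> r M N. \<gamma> \<noteq> 0 \<and> r \<noteq> 0 \<and>
        (\<forall>A \<in> toeplitz_space n. T A = M * A * N) \<and>
        M = \<gamma> \<cdot>\<^sub>m (flip_mat n * transpose_mat N * flip_mat n) \<and>
        ((\<exists>\<alpha>. N = V_mat n \<alpha> * geom_diag n r) \<or>
         (\<exists>\<alpha>. N = V_mat n \<alpha> * flip_mat n * geom_diag n r) \<or>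
         (\<exists>\<alpha> \<beta>. \<alpha> \<noteq> \<beta> \<and> N = W_mat n \<alpha> \<beta> * geom_diag n r)))"

lemma jordan_lower_carrier [simp]: "jordan_lower n \<alpha> \<in> carrier_mat n n"
  by (simp add: jordan_lower_def lower_shift_def)

lemma jordan_lower_dim [simp]:
  "dim_row (jordan_lower n \<alpha>) = n" "dim_col (jordan_lower n \<alpha>) = n"
  using jordan_lower_carrier[of n \<alpha>] by (blast dest: carrier_matD)+

lemma jordan_lower_pow_Suc:
  "jordan_lower n \<alpha> ^\<^sub>m Suc k = jordan_lower n \<alpha> * jordan_lower n \<alpha> ^\<^sub>m k"
proof (induction k)
  case 0
  then show ?case using jordan_lower_carrier[of n \<alpha>] by simp
next
  case (Suc k)
  have P: "jordan_lower n \<alpha> ^\<^sub>m k \<in> carrier_mat n n"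
    by (rule pow_carrier_mat) simp
  have "jordan_lower n \<alpha> ^\<^sub>m Suc (Suc k)
          = (jordan_lower n \<alpha> * jordan_lower n \<alpha> ^\<^sub>m k) * jordan_lower n \<alpha>"
    using Suc by simp
  also have "\<dots> = jordan_lower n \<alpha> * (jordan_lower n \<alpha> ^\<^sub>m k * jordan_lower n \<alpha>)"
    by (rule assoc_mult_mat[OF jordan_lower_carrier P jordan_lower_carrier])
  finally show ?case by simp
qed

lemma jordan_lower_mult_vec_entry:
  assumes i: "i < n" and w: "w \<in> carrier_vec n"
  shows "(jordan_lower n \<alpha> *\<^sub>v w) $ i = \<alpha> * w $ i + (if i = 0 then 0 else w $ (i - 1))"
proof -
  have "(jordan_lower n \<alpha> *\<^sub>v w) $ i
          = (\<Sum>j = 0..<n. (\<alpha> * (if i = j then 1 else 0) + (if i = Suc j then 1 else 0)) * w $ j)"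
    using i w
    by (auto simp: jordan_lower_def lower_shift_def scalar_prod_def intro!: sum.cong)
  also have "\<dots> = (\<Sum>j = 0..<n. (if j = i then \<alpha> * w $ i else 0))
                  + (\<Sum>j = 0..<n. (if i = Suc j then w $ j else 0))"
    unfolding sum.distrib[symmetric] by (rule sum.cong) (auto simp: algebra_simps)
  also have "(\<Sum>j = 0..<n. (if j = i then \<alpha> * w $ i else 0)) = \<alpha> * w $ i"
    using i by simp
  also have "(\<Sum>j = 0..<n. (if i = Suc j then w $ j else 0))
               = (if i = 0 then 0 else w $ (i - 1))"
    using i by (cases i) simp_all
  finally show ?thesis .
qed

lemma jordan_lower_pow_entry:
  assumes "i < n"
  shows "((jordan_lower n \<alpha> ^\<^sub>m k) *\<^sub>v unit_vec n 0) $ i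
           = of_nat (k choose i) * \<alpha> ^ (k - i)"
  using assms
proof (induction k arbitrary: i)
  case 0
  have "jordan_lower n \<alpha> ^\<^sub>m 0 = 1\<^sub>m n"
    by simp
  then have "(jordan_lower n \<alpha> ^\<^sub>m 0) *\<^sub>v unit_vec n 0 = unit_vec n 0"
    by simp
  then show ?case
    using 0 by (cases i) simp_all
next
  case (Suc k)
  have P: "jordan_lower n \<alpha> ^\<^sub>m k \<in> carrier_mat n n"
    by (rule pow_carrier_mat) simp
  define w where "w = (jordan_lower n \<alpha> ^\<^sub>m k) *\<^sub>v unit_vec n 0"
  have w: "w \<in> carrier_vec n"
    unfolding w_def using P by (rule mult_mat_vec_carrier) simp
  have "(jordan_lower n \<alpha> ^\<^sub>m Suc k) *\<^sub>v unit_vec n 0 = jordan_lower n \<alpha> *\<^sub>v w"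
    unfolding jordan_lower_pow_Suc w_def
    by (rule assoc_mult_mat_vec[OF jordan_lower_carrier P]) simp
  then have eq: "((jordan_lower n \<alpha> ^\<^sub>m Suc k) *\<^sub>v unit_vec n 0) $ i
               = \<alpha> * w $ i + (if i = 0 then 0 else w $ (i - 1))"
    using jordan_lower_mult_vec_entry[OF Suc.prems w] by simp
  have IH: "w $ l = of_nat (k choose l) * \<alpha> ^ (k - l)" if "l < n" for l
    using Suc.IH[OF that] by (simp add: w_def)
  show ?case
  proof (cases i)
    case 0
    then show ?thesis using eq IH[of 0] Suc.prems by simp
  next
    case (Suc l)
    have "\<alpha> * (of_nat (k choose Suc l) * \<alpha> ^ (k - Suc l))
            = of_nat (k choose Suc l) * \<alpha> ^ (k - l)"
    proof (cases "Suc l \<le> k")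
      case True
      then have "k - l = Suc (k - Suc l)" by simp
      then show ?thesis by simp
    qed (simp add: binomial_eq_0)
    then show ?thesis
      using eq IH[of i] IH[of l] Suc Suc.prems by (simp add: algebra_simps)
  qed
qed

text \<open>The entrywise description of \<^const>\<open>V_mat\<close>: it is upper triangular since
  \<open>j choose i = 0\<close> for \<open>j < i\<close>.\<close>

lemma V_mat_entry:
  assumes "i < n" "j < n"
  shows "V_mat n \<alpha> $$ (i, j) = of_nat (j choose i) * \<alpha> ^ (j - i)"
  using assms jordan_lower_pow_entry[of i n \<alpha> j]
  by (simp add: V_mat_def mat_of_cols_index)

end

(*
  Every matrix N of the three forms is the matrix of the n-1-st symmetric power of an invertible
  pair of linear forms a, b, its j-th column being the coefficients of a^(n-1-j) b^j.
  For the converse, the Toeplitz matrices of the moment sequences (t^k) have rank one, hence so have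
  their images under T. The entries of these images are polynomials p_l in t which therefore satisfy
  p_l p_(l+2) = p_(l+1)^2 and which span all polynomials of degree at most 2n-2, because T is
  injective. Factoriality of the polynomial ring forces p_l = g a^(2n-2-l) b^l with independent
  linear forms a and b: the rational normal curve. The map A -> MAN given by a and b agrees with T
  on moment matrices, and these span the Toeplitz matrices.
*)

theory Submission
  imports Defs "HOL-Computational_Algebra.Polynomial_Factorial"
    "HOL-Computational_Algebra.Field_as_Ring"
begin

section \<open>Rank factorizations and the rank of products\<close>

text \<open>The columns of \<open>B\<close> are a basis of the column space of \<open>A\<close>, and
  the columns of \<open>C\<close> are the coordinates of the columns of \<open>A\<close> in it. All
  rank estimates below go through this factorization.\<close>

lemma (in vec_space) rank_factorization:
  assumes A: "A \<in> carrier_mat n nc"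
  obtains B C where "B \<in> carrier_mat n (rank A)" "C \<in> carrier_mat (rank A) nc" "A = B * C"
proof -
  let ?S = "set (cols A)"
  have S: "?S \<subseteq> carrier_vec n"
    using A cols_dim by blast
  have vs: "vectorspace class_ring (span_vs ?S)"
    using span_is_subspace[OF S] by (rule subspace_is_vs)
  have fd: "vectorspace.fin_dim class_ring (span_vs ?S)"
    using fin_dim_span_cols[OF A] .
  obtain \<beta> where fin: "finite \<beta>" and bas: "vectorspace.basis class_ring (span_vs ?S) \<beta>"
    using vectorspace.finite_basis_exists[OF vs fd] by blast
  have card: "rank A = card \<beta>"
    unfolding rank_def using vectorspace.dim_basis[OF vs fin bas] .
  have sub: "\<beta> \<subseteq> span ?S"
    using bas unfolding vectorspace.basis_def[OF vs] by simp
  have gen: "LinearCombinations.module.span class_ring (span_vs ?S) \<beta> = span ?S"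
    using bas unfolding vectorspace.basis_def[OF vs] by simp
  \<comment> \<open>A basis of the column space generates it inside that subspace; this moves the
    statement to the span in the ambient space.\<close>
  have spn: "span \<beta> = span ?S"
    using span_li_not_depend(1)[OF sub span_is_submodule[OF S]] gen by simp
  have \<beta>: "\<beta> \<subseteq> carrier_vec n"
    using sub span_is_subset2[OF S] by auto
  obtain xs where xs: "set xs = \<beta>" "distinct xs"
    using finite_distinct_list[OF fin] by blast
  then have len: "length xs = rank A"
    using card distinct_card by metis
  define B where "B = mat_of_cols n xs"
  have B: "B \<in> carrier_mat n (rank A)"
    unfolding B_def using len by auto
  have colsB: "set (cols B) = \<beta>"
    unfolding B_def using xs \<beta> by (simp add: cols_mat_of_cols)
  have ex: "\<exists>x. x \<in> carrier_vec (rank A) \<and> B *\<^sub>v x = col A j" if "j < nc" for j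
  proof -
    have "col A j \<in> ?S"
      using that A by (metis carrier_matD(2) cols_length cols_nth nth_mem)
    then have "col A j \<in> span (set (cols B))"
      using in_own_span[OF S] spn colsB by auto
    then show ?thesis
      using col_space_eq[OF B] B unfolding col_space_def by auto
  qed
  then obtain x where x: "\<And>j. j < nc \<Longrightarrow> x j \<in> carrier_vec (rank A) \<and> B *\<^sub>v x j = col A j"
    by metis
  define C where "C = mat_of_cols (rank A) (map x [0..<nc])"
  have C: "C \<in> carrier_mat (rank A) nc"
    unfolding C_def by auto
  have "A = B * C"
  proof (rule mat_col_eqI)
    fix j assume "j < dim_col (B * C)"
    then have j: "j < nc"
      using C by simp
    then have "col C j = x j"
      unfolding C_def using x by simp
    then show "col A j = col (B * C) j"
      using x[OF j] col_mult2[OF B C j] by simp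
  qed (use A B C in auto)
  then show thesis
    using that B C by blast
qed

text \<open>The columns of \<open>B * C\<close> lie in the column space of \<open>B\<close>, which
  is spanned by \<open>r\<close> vectors.\<close>

lemma (in vec_space) rank_mult_le:
  assumes B: "B \<in> carrier_mat n r" and C: "C \<in> carrier_mat r nc"
  shows "rank (B * C) \<le> r"
proof -
  have A: "B * C \<in> carrier_mat n nc"
    using B C by simp
  have SB: "set (cols B) \<subseteq> carrier_vec n" and SA: "set (cols (B * C)) \<subseteq> carrier_vec n"
    using B C A cols_dim by blast+
  have "set (cols (B * C)) \<subseteq> span (set (cols B))"
  proof
    fix v assume "v \<in> set (cols (B * C))"
    then obtain j where j: "j < nc" "v = col (B * C) j"
      using A by (auto simp: in_set_conv_nth)
    then have "v = B *\<^sub>v col C j"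
      using col_mult2[OF B C] by simp
    moreover have "col C j \<in> carrier_vec r"
      using C by auto
    ultimately have "v \<in> col_space B"
      using col_space_eq[OF B] B by auto
    then show "v \<in> span (set (cols B))"
      unfolding col_space_def .
  qed
  then have sub: "span (set (cols (B * C))) \<subseteq> span (set (cols B))"
    using span_is_submodule[OF SB] span_is_subset by blast
  have subsp: "VectorSpace.subspace class_ring (span (set (cols (B * C)))) (span_vs (set (cols B)))"
    using nested_subspaces[OF span_is_subspace[OF SB] span_is_subspace[OF SA] sub] .
  have vs: "vectorspace class_ring (span_vs (set (cols B)))"
    using span_is_subspace[OF SB] by (rule subspace_is_vs)
  have "rank (B * C) \<le> rank B"
    unfolding rank_def
    using vectorspace.subspace_dim[OF vs subsp] fin_dim_span_cols[OF A] fin_dim_span_cols[OF B]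
    by simp
  also have "\<dots> \<le> r"
    using rank_le_nc[OF B] .
  finally show ?thesis .
qed

text \<open>Outer factors are absorbed into a rank factorization \<open>A = B * C\<close> without
  changing its inner dimension.\<close>

lemma (in vec_space) rank_mult_mult_le:
  assumes M: "M \<in> carrier_mat n n" and A: "A \<in> carrier_mat n nc" and N: "N \<in> carrier_mat nc nc"
  shows "rank (M * A * N) \<le> rank A"
proof -
  obtain B C where BC: "B \<in> carrier_mat n (rank A)" "C \<in> carrier_mat (rank A) nc" "A = B * C"
    using rank_factorization[OF A] .
  have "M * (B * C) * N = (M * B) * (C * N)"
    using assms BC(1,2) assoc_mult_mat[of M n n B "rank A" C nc]
      assoc_mult_mat[of "M * B" n "rank A" C nc N nc] by simp
  then have "M * A * N = (M * B) * (C * N)"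
    using BC(3) by simp
  moreover have "rank ((M * B) * (C * N)) \<le> rank A"
    using M N BC(1,2) by (intro rank_mult_le[of _ _ _ nc]) auto
  ultimately show ?thesis
    by simp
qed

lemma det_nonzero_inverse:
  fixes A :: "'a::field mat"
  assumes "A \<in> carrier_mat n n" "det A \<noteq> 0"
  obtains B where "B \<in> carrier_mat n n" "B * A = 1\<^sub>m n" "A * B = 1\<^sub>m n"
  \<comment> \<open>\<open>undefined\<close> fills a dummy parameter of the matrix ring; the set of
    units does not depend on it.\<close>
  using det_non_zero_imp_unit[OF assms, of undefined] that
  unfolding Units_def ring_mat_def by auto

text \<open>The previous bound is applied twice, the second time to the inverses of \<open>M\<close>
  and \<open>N\<close>, which recover \<open>A\<close>.\<close>

lemma (in vec_space) rank_mult_invertible: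
  assumes M: "M \<in> carrier_mat n n" "det M \<noteq> 0"
    and A: "A \<in> carrier_mat n n"
    and N: "N \<in> carrier_mat n n" "det N \<noteq> 0"
  shows "rank (M * A * N) = rank A"
proof (rule antisym)
  show "rank (M * A * N) \<le> rank A"
    using assms by (intro rank_mult_mult_le)
  obtain M' where M': "M' \<in> carrier_mat n n" "M' * M = 1\<^sub>m n"
    using det_nonzero_inverse[OF M] .
  obtain N' where N': "N' \<in> carrier_mat n n" "N * N' = 1\<^sub>m n"
    using det_nonzero_inverse[OF N] .
  have "M' * (M * A * N) * N' = M' * (M * A) * (N * N')"
    using M A N M' N' assoc_mult_mat[of M' n n "M * A" n N n]
      assoc_mult_mat[of "M' * (M * A)" n n N n N' n] by simp
  also have "M' * (M * A) = (M' * M) * A"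
    using M A M' assoc_mult_mat[of M' n n M n A n] by simp
  finally have "M' * (M * A * N) * N' = A"
    using A M' N' by simp
  then show "rank A \<le> rank (M * A * N)"
    using rank_mult_mult_le[of M' "M * A * N" n N'] M A N M' N' by simp
qed

lemma (in vec_space) rank_eq_0_iff:
  assumes A: "A \<in> carrier_mat n nc"
  shows "rank A = 0 \<longleftrightarrow> A = 0\<^sub>m n nc"
proof
  assume r: "rank A = 0"
  obtain B C where BC: "B \<in> carrier_mat n (rank A)" "C \<in> carrier_mat (rank A) nc" "A = B * C"
    using rank_factorization[OF A] .
  then show "A = 0\<^sub>m n nc"
    using r by (intro eq_matI) (auto simp: scalar_prod_def)
qed (simp add: rank_0I)

text \<open>With inner dimension one, every entry is a product of a row factor and a column factor,
  so both sides contain the same four factors; with inner dimension zero all entries vanish.\<close>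

lemma (in vec_space) rank_le_1_minor:
  assumes A: "A \<in> carrier_mat n nc" and r: "rank A \<le> 1"
    and "i < n" "i' < n" "j < nc" "j' < nc"
  shows "A $$ (i, j) * A $$ (i', j') = A $$ (i, j') * A $$ (i', j)"
proof -
  obtain B C where BC: "B \<in> carrier_mat n (rank A)" "C \<in> carrier_mat (rank A) nc" "A = B * C"
    using rank_factorization[OF A] .
  have "A $$ (k, l) = (\<Sum>s\<in>{0..<rank A}. B $$ (k, s) * C $$ (s, l))" if "k < n" "l < nc" for k l
  proof -
    have "(B * C) $$ (k, l) = (\<Sum>s\<in>{0..<rank A}. B $$ (k, s) * C $$ (s, l))"
      using BC(1,2) that by (auto simp: scalar_prod_def)
    then show ?thesis
      using BC(3) by simp
  qed
  moreover have "rank A = 0 \<or> rank A = 1"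
    using r by linarith
  ultimately show ?thesis
    using assms(3-) by auto
qed

section \<open>Linear forms and the rational normal curve\<close>

lemma linear_poly_eq:
  fixes a :: "'a::comm_ring_1 poly"
  assumes "degree a \<le> 1"
  shows "a = [:coeff a 0, coeff a 1:]"
proof (rule poly_eqI)
  fix i
  have "i = 0 \<or> i = 1 \<or> degree a < i"
    using assms by linarith
  then show "coeff a i = coeff [:coeff a 0, coeff a 1:] i"
    by (auto simp: coeff_eq_0 coeff_pCons split: nat.splits)
qed

text \<open>The condition \<open>minors\<close> makes the \<open>p l\<close> a geometric progression
  in the field of rational functions. Writing its quotient in lowest terms as \<open>b / a\<close>
  forces \<open>a ^ m\<close> into \<open>p 0\<close>; the spanning condition then excludes a common
  factor and dependent forms.\<close>

lemma rational_normal_curve: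
  fixes p :: "nat \<Rightarrow> 'a::field_gcd poly"
  assumes deg: "\<And>l. l \<le> m \<Longrightarrow> degree (p l) \<le> m"
    and nz: "\<And>l. l \<le> m \<Longrightarrow> p l \<noteq> 0"
    and minors: "\<And>l. l + 2 \<le> m \<Longrightarrow> p l * p (l + 2) = p (l + 1) ^ 2"
    and spanning: "\<And>k. k \<le> m \<Longrightarrow> \<exists>c. (\<Sum>l\<le>m. Polynomial.smult (c l) (p l)) = monom 1 k"
  obtains g a b where "g \<noteq> 0" "degree a \<le> 1" "degree b \<le> 1"
    "coeff a 0 * coeff b 1 \<noteq> coeff a 1 * coeff b 0"
    "\<And>l. l \<le> m \<Longrightarrow> p l = Polynomial.smult g (a ^ (m - l) * b ^ l)"
proof (cases "m = 0")
  case True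
  obtain g where g: "p 0 = [:g:]"
    using deg[of 0] True degree_0_id by (metis le_zero_eq)
  then have "g \<noteq> 0"
    using nz[of 0] True by auto
  \<comment> \<open>For \<open>m = 0\<close> the forms do not enter \<open>p 0\<close>, so any
    independent pair will do.\<close>
  then show thesis
    using that[of g 1 "[:0, 1:]"] g True by simp
next
  case False
  then have m: "1 \<le> m"
    by simp
  \<comment> \<open>The quotient of consecutive terms stays equal to \<open>p 1 / p 0\<close>; the
    induction step cancels the nonzero factor \<open>p l\<close>.\<close>
  have cross: "p 0 * p (l + 1) = p 1 * p l" if "l + 1 \<le> m" for l
    using that
  proof (induction l)
    case (Suc l)
    have "p l * (p 0 * p (l + 2)) = p 0 * p (l + 1) ^ 2"
      using minors[of l] Suc.prems by (simp add: algebra_simps)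
    also have "\<dots> = (p 0 * p (l + 1)) * p (l + 1)"
      by (simp add: power2_eq_square)
    also have "\<dots> = p l * (p 1 * p (l + 1))"
      using Suc by simp
    finally show ?case
      using nz[of l] Suc.prems by simp
  qed simp
  \<comment> \<open>Dividing by the gcd reduces the quotient \<open>p 1 / p 0\<close> to lowest
    terms.\<close>
  define d where "d = gcd (p 0) (p 1)"
  have d: "d \<noteq> 0"
    using nz[of 0] unfolding d_def by simp
  obtain a b where ab: "p 0 = a * d" "p 1 = b * d" and cop: "coprime a b"
    using gcd_coprime_exists[of "p 0" "p 1"] d unfolding d_def by blast
  have a: "a \<noteq> 0" and b: "b \<noteq> 0"
    using ab nz[of 0] nz[of 1] m by auto
  have step: "a * p (l + 1) = b * p l" if "l + 1 \<le> m" for l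
    using cross[OF that] d unfolding ab by (simp add: mult.assoc mult.left_commute[of _ d])
  have pow: "a ^ l * p l = b ^ l * p 0" if "l \<le> m" for l
    using that
  proof (induction l)
    case (Suc l)
    have "a ^ Suc l * p (Suc l) = a ^ l * (b * p l)"
      using step[of l] Suc.prems by (simp add: mult.assoc mult.left_commute)
    also have "\<dots> = b ^ Suc l * p 0"
      using Suc by (simp add: mult.left_commute mult.assoc)
    finally show ?case .
  qed simp
  \<comment> \<open>Only the last index \<open>m\<close> is needed to bring the full power
    \<open>a ^ m\<close> into \<open>p 0\<close>, since \<open>b ^ m\<close> is coprime to
    it.\<close>
  have "a ^ m dvd b ^ m * p 0"
    using pow[of m] by (metis dvd_triv_left order_refl)
  moreover have "coprime (a ^ m) (b ^ m)"
    using cop by simp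
  ultimately have "a ^ m dvd p 0"
    using coprime_dvd_mult_right_iff by blast
  then obtain h where h: "p 0 = a ^ m * h"
    by (elim dvdE)
  have form: "p l = h * (a ^ (m - l) * b ^ l)" if "l \<le> m" for l
  proof -
    have "a ^ l * p l = b ^ l * (a ^ (l + (m - l)) * h)"
      using pow[OF that] h that by simp
    also have "\<dots> = a ^ l * (h * (a ^ (m - l) * b ^ l))"
      by (simp only: power_add mult_ac)
    finally show ?thesis
      using a by simp
  qed
  \<comment> \<open>\<open>h\<close> divides every \<open>p l\<close>, hence every linear
    combination of them, and the constant 1 is one.\<close>
  have "h dvd 1"
  proof -
    obtain c where "(\<Sum>l\<le>m. Polynomial.smult (c l) (p l)) = monom 1 0"
      using spanning[of 0] by auto
    moreover have "h dvd (\<Sum>l\<le>m. Polynomial.smult (c l) (p l))"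
      using form by (intro dvd_sum dvd_smult) auto
    ultimately show ?thesis
      by simp
  qed
  then obtain g where g: "h = [:g:]" "g \<noteq> 0"
    using is_unit_polyE[of h] not_is_unit_0 by metis
  have form': "p l = Polynomial.smult g (a ^ (m - l) * b ^ l)" if "l \<le> m" for l
    using form[OF that] g by simp
  \<comment> \<open>Up to the constant \<open>g\<close>, the two ends of the family are
    \<open>a ^ m\<close> and \<open>b ^ m\<close>, so the degree bound \<open>m\<close> limits each
    form to degree one.\<close>
  have dega: "degree a \<le> 1"
    using deg[of 0] form'[of 0] g a m by (simp add: degree_power_eq)
  have degb: "degree b \<le> 1"
    using deg[of m] form'[of m] g b m by (simp add: degree_power_eq)
  \<comment> \<open>Dependent coprime forms would both be constant. Then every \<open>p l\<close>
    would be constant, and the monomial of degree one would lie outside their span.\<close>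
  have "coeff a 0 * coeff b 1 \<noteq> coeff a 1 * coeff b 0"
  proof
    assume eq: "coeff a 0 * coeff b 1 = coeff a 1 * coeff b 0"
    have sm: "Polynomial.smult (coeff b 1) a = Polynomial.smult (coeff a 1) b"
    proof -
      have "Polynomial.smult (coeff b 1) [:coeff a 0, coeff a 1:] = Polynomial.smult (coeff a 1) [:coeff b 0, coeff b 1:]"
        using eq by (simp add: mult.commute)
      then show ?thesis
        by (simp only: linear_poly_eq[OF dega, symmetric] linear_poly_eq[OF degb, symmetric])
    qed
    have "coeff a 1 = 0"
    proof (rule ccontr)
      assume a1: "coeff a 1 \<noteq> 0"
      then have "b = Polynomial.smult (coeff b 1 / coeff a 1) a"
        using arg_cong[OF sm, of "Polynomial.smult (1 / coeff a 1)"] by simp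
      then have "a dvd b"
        by (metis dvd_refl dvd_smult)
      then have "a dvd 1"
        using cop by (metis coprime_common_divisor dvd_refl)
      then show False
        using a1 by (auto elim: is_unit_polyE)
    qed
    moreover have "coeff b 1 = 0"
    proof (rule ccontr)
      assume b1: "coeff b 1 \<noteq> 0"
      then have "a = Polynomial.smult (coeff a 1 / coeff b 1) b"
        using arg_cong[OF sm, of "Polynomial.smult (1 / coeff b 1)"] by simp
      then have "b dvd a"
        by (metis dvd_refl dvd_smult)
      then have "b dvd 1"
        using cop by (metis coprime_common_divisor dvd_refl)
      then show False
        using b1 by (auto elim: is_unit_polyE)
    qed
    ultimately have "degree a \<noteq> 1" "degree b \<noteq> 1"
      using a b leading_coeff_neq_0 by metis+
    then have ab0: "degree a = 0" "degree b = 0"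
      using dega degb by auto
    have p1: "coeff (p l) 1 = 0" if "l \<le> m" for l
    proof -
      have "degree (a ^ (m - l) * b ^ l) = 0"
        using a b ab0 by (simp add: degree_mult_eq degree_power_eq)
      then show ?thesis
        using form'[OF that] by (simp add: coeff_eq_0)
    qed
    obtain c where c: "(\<Sum>l\<le>m. Polynomial.smult (c l) (p l)) = monom 1 1"
      using spanning[OF m] by auto
    have "(\<Sum>l\<le>m. c l * coeff (p l) 1) = 1"
      using arg_cong[OF c, of "\<lambda>q. coeff q 1"] by (simp add: coeff_sum)
    then show False
      using p1 by simp
  qed
  then show thesis
    using that[OF g(2) dega degb _ form'] by blast
qed

text \<open>The three shapes of a pair of linear forms up to scaling, according to whether the
  first, the second or neither of the two has its root at infinity.\<close>

definition normal_pair :: "'a::comm_ring_1 poly \<Rightarrow> 'a poly \<Rightarrow> bool" where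
  "normal_pair a b \<longleftrightarrow>
     (\<exists>\<alpha>. a = 1 \<and> b = [:\<alpha>, 1:]) \<or>
     (\<exists>\<alpha>. a = [:\<alpha>, 1:] \<and> b = 1) \<or>
     (\<exists>\<alpha> \<beta>. \<alpha> \<noteq> \<beta> \<and> a = [:\<beta>, 1:] \<and> b = [:\<alpha>, 1:])"

text \<open>Each form is divided by its coefficient of degree one, or by its constant coefficient if
  that one is zero. Independence keeps the divisors nonzero and the roots distinct.\<close>

lemma normal_pairE:
  fixes a b :: "'a::field poly"
  assumes "degree a \<le> 1" "degree b \<le> 1" and det: "coeff a 0 * coeff b 1 \<noteq> coeff a 1 * coeff b 0"
  obtains s u a' b' where "s \<noteq> 0" "u \<noteq> 0" "normal_pair a' b'" "a = Polynomial.smult s a'" "b = Polynomial.smult u b'"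
proof -
  obtain a0 a1 b0 b1 where a: "a = [:a0, a1:]" and b: "b = [:b0, b1:]"
    using linear_poly_eq assms(1,2) by blast
  have det: "a0 * b1 \<noteq> a1 * b0"
    using det unfolding a b by simp
  consider "a1 = 0" | "b1 = 0" | "a1 \<noteq> 0" "b1 \<noteq> 0"
    by blast
  then show thesis
  proof cases
    case 1
    then show thesis
      using det by (intro that[of a0 b1 1 "[:b0 / b1, 1:]"]) (auto simp: normal_pair_def a b)
  next
    case 2
    then show thesis
      using det by (intro that[of a1 b0 "[:a0 / a1, 1:]" 1]) (auto simp: normal_pair_def a b)
  next
    case 3
    then have "b0 / b1 \<noteq> a0 / a1"
      using det by (auto simp: field_simps)
    then have "normal_pair [:a0 / a1, 1:] [:b0 / b1, 1:]"
      unfolding normal_pair_def by blast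
    with 3 show thesis
      by (intro that[of a1 b1 "[:a0 / a1, 1:]" "[:b0 / b1, 1:]"]) (auto simp: a b)
  qed
qed

lemma normal_pair_det:
  assumes "normal_pair a b"
  shows "degree a \<le> 1" "degree b \<le> 1" "coeff a 0 * coeff b 1 \<noteq> coeff a 1 * coeff b 0"
  using assms by (auto simp: normal_pair_def)

lemma rational_normal_curve_normal_form:
  fixes p :: "nat \<Rightarrow> 'a::field_gcd poly"
  assumes "\<And>l. l \<le> m \<Longrightarrow> degree (p l) \<le> m"
    and "\<And>l. l \<le> m \<Longrightarrow> p l \<noteq> 0"
    and "\<And>l. l + 2 \<le> m \<Longrightarrow> p l * p (l + 2) = p (l + 1) ^ 2"
    and "\<And>k. k \<le> m \<Longrightarrow> \<exists>c. (\<Sum>l\<le>m. Polynomial.smult (c l) (p l)) = monom 1 k"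
  obtains \<gamma> r a b where "\<gamma> \<noteq> 0" "r \<noteq> 0" "normal_pair a b"
    "\<And>l. l \<le> m \<Longrightarrow> p l = Polynomial.smult \<gamma> (a ^ (m - l) * Polynomial.smult r b ^ l)"
proof -
  obtain g a b where g: "g \<noteq> 0" and ab: "degree a \<le> 1" "degree b \<le> 1"
      "coeff a 0 * coeff b 1 \<noteq> coeff a 1 * coeff b 0"
    and form: "\<And>l. l \<le> m \<Longrightarrow> p l = Polynomial.smult g (a ^ (m - l) * b ^ l)"
    using rational_normal_curve[of m p] assms by blast
  obtain s u a' b' where su: "s \<noteq> 0" "u \<noteq> 0" and np: "normal_pair a' b'"
    and eq: "a = Polynomial.smult s a'" "b = Polynomial.smult u b'"
    using normal_pairE[OF ab] .
  show thesis
  \<comment> \<open>Since \<open>s ^ (m - l) * u ^ l = s ^ m * (u / s) ^ l\<close>, one scalar goes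
    into the global factor and the other becomes the ratio \<open>r\<close> of the diagonal
    matrix.\<close>
  proof (rule that[of "g * s ^ m" "u / s" a' b'])
    fix l assume l: "l \<le> m"
    then have "s ^ m = s ^ (m - l) * s ^ l"
      by (simp flip: power_add)
    then show "p l = Polynomial.smult (g * s ^ m) (a' ^ (m - l) * Polynomial.smult (u / s) b' ^ l)"
      using su by (simp add: form[OF l] eq smult_power power_divide mult_ac)
  qed (use g su np in auto)
qed

subsection \<open>Toeplitz matrices\<close>

text \<open>Toeplitz matrices are indexed by their \<open>2n - 1\<close> diagonals starting in the lower left corner,
  so that flipping the rows of \<open>toep n h\<close> gives the Hankel matrix of the sequence \<open>h\<close>.\<close>

definition toep :: "nat \<Rightarrow> (nat \<Rightarrow> 'a::field) \<Rightarrow> 'a mat" where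
  "toep n h = mat n n (\<lambda>(i, j). h (n - 1 - i + j))"

text \<open>Truncated subtraction lets one formula run up the first column for \<open>l < n\<close>
  and then along the first row.\<close>

definition diagonal_entry :: "nat \<Rightarrow> 'a mat \<Rightarrow> nat \<Rightarrow> 'a" where
  "diagonal_entry n A l = A $$ (n - 1 - l, l - (n - 1))"

lemma toep_carrier [simp]: "toep n h \<in> carrier_mat n n"
  by (simp add: toep_def)

lemma toep_index: "i < n \<Longrightarrow> j < n \<Longrightarrow> toep n h $$ (i, j) = h (n - 1 - i + j)"
  by (simp add: toep_def)

lemma toep_in_space [simp]: "toep n h \<in> toeplitz_space n"
proof -
  have "toep n h = mat n n (\<lambda>(i, j). h (nat (int (n - 1) - (int i - int j))))"
    unfolding toep_def by (intro cong_mat) (auto simp: nat_diff_distrib' intro!: arg_cong[of _ _ h])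
  then show ?thesis
    unfolding toeplitz_space_def by (auto intro!: exI[of _ "\<lambda>d. h (nat (int (n - 1) - d))"])
qed

lemma toeplitz_space_carrier: "A \<in> toeplitz_space n \<Longrightarrow> A \<in> carrier_mat n n"
  by (auto simp: toeplitz_space_def)

lemma diagonal_entry_toep: "l < 2 * n - 1 \<Longrightarrow> diagonal_entry n (toep n h) l = h l"
  unfolding diagonal_entry_def by (subst toep_index) (auto intro!: arg_cong[of _ _ h])

lemma toep_diagonal_entry:
  assumes "A \<in> toeplitz_space n"
  shows "A = toep n (diagonal_entry n A)"
proof -
  obtain a :: "int \<Rightarrow> 'a" where a: "A = mat n n (\<lambda>(i, j). a (int i - int j))"
    using assms unfolding toeplitz_space_def by blast
  show ?thesis
    unfolding a toep_def
    by (intro cong_mat) (auto simp: diagonal_entry_def intro!: arg_cong[of _ _ a])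
qed

lemma toep_cong: "(\<And>l. l < 2 * n - 1 \<Longrightarrow> h l = h' l) \<Longrightarrow> toep n h = toep n h'"
  unfolding toep_def by (intro cong_mat) auto

lemma toep_add: "toep n (\<lambda>l. h l + h' l) = toep n h + toep n h'"
  by (intro eq_matI) (auto simp: toep_def)

lemma toep_smult: "toep n (\<lambda>l. c * h l) = c \<cdot>\<^sub>m toep n h"
  by (intro eq_matI) (auto simp: toep_def)

section \<open>Linear functionals on the Toeplitz space\<close>

text \<open>This treats the entries of \<open>T A\<close> and of \<open>M * A * N\<close> alike, so
  that the two maps can be compared entry by entry.\<close>

definition toeplitz_functional :: "nat \<Rightarrow> ('a::field mat \<Rightarrow> 'a) \<Rightarrow> bool" where
  "toeplitz_functional n F \<longleftrightarrow>
     (\<forall>A \<in> toeplitz_space n. \<forall>B \<in> toeplitz_space n. F (A + B) = F A + F B) \<and>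
     (\<forall>c. \<forall>A \<in> toeplitz_space n. F (c \<cdot>\<^sub>m A) = c * F A)"

abbreviation diagonal_unit :: "nat \<Rightarrow> nat \<Rightarrow> 'a::field mat" where
  "diagonal_unit n k \<equiv> toep n (\<lambda>l. if l = k then 1 else 0)"

lemma toeplitz_functional_toep:
  assumes "toeplitz_functional n F"
  shows "F (toep n h) = (\<Sum>k<2 * n - 1. h k * F (diagonal_unit n k))"
proof -
  have add: "F (toep n (\<lambda>l. f l + g l)) = F (toep n f) + F (toep n g)" for f g
    using assms unfolding toep_add toeplitz_functional_def by simp
  have smult: "F (toep n (\<lambda>l. c * f l)) = c * F (toep n f)" for c f
    using assms unfolding toep_smult toeplitz_functional_def by simp
  \<comment> \<open>Truncating the sequence at \<open>K\<close> allows an induction that adds one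
    diagonal at a time.\<close>
  have "F (toep n (\<lambda>l. if l < K then h l else 0)) = (\<Sum>k<K. h k * F (diagonal_unit n k))" for K
  proof (induction K)
    case 0
    show ?case
      using smult[of 0 "\<lambda>_. 0"] by simp
  next
    case (Suc K)
    have "(\<lambda>l. if l < Suc K then h l else 0) =
        (\<lambda>l. (if l < K then h l else 0) + h K * (if l = K then 1 else 0))"
      by (auto simp: less_Suc_eq)
    then show ?case
      using Suc by (simp only: add smult sum.lessThan_Suc)
  qed
  moreover have "toep n h = toep n (\<lambda>l. if l < 2 * n - 1 then h l else 0)"
    by (rule toep_cong) simp
  ultimately show ?thesis
    by metis
qed

text \<open>On moment matrices a functional is a polynomial in \<open>t\<close> whose coefficients
  are its values on the \<open>diagonal_unit\<close> matrices. Over an infinite field the values of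
  a polynomial determine its coefficients.\<close>

lemma toeplitz_functional_eqI:
  fixes F G :: "'a::field_char_0 mat \<Rightarrow> 'a"
  assumes F: "toeplitz_functional n F" and G: "toeplitz_functional n G"
    and eq: "\<And>t. F (toep n (\<lambda>k. t ^ k)) = G (toep n (\<lambda>k. t ^ k))"
    and A: "A \<in> toeplitz_space n"
  shows "F A = G A"
proof -
  let ?p = "\<lambda>F. \<Sum>k<2 * n - 1. monom (F (diagonal_unit n k) :: 'a) k"
  have coeff: "coeff (?p F) k = F (diagonal_unit n k)" if "k < 2 * n - 1" for F k
    using that by (simp add: coeff_sum)
  have poly: "poly (?p H) t = H (toep n (\<lambda>k. t ^ k))" if "toeplitz_functional n H" for H t
    using toeplitz_functional_toep[OF that, of "\<lambda>k. t ^ k"]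
    by (simp add: poly_sum poly_monom mult.commute)
  have "poly (?p F) = poly (?p G)"
    using eq by (intro ext) (simp only: poly[OF F] poly[OF G])
  then have "?p F = ?p G"
    by (simp only: poly_eq_poly_eq_iff)
  then have "F (diagonal_unit n k) = G (diagonal_unit n k)" if "k < 2 * n - 1" for k
    using coeff[OF that, of F] coeff[OF that, of G] by (simp only:)
  then have toep: "F (toep n h) = G (toep n h)" for h
    using toeplitz_functional_toep[OF F, of h] toeplitz_functional_toep[OF G, of h] by simp
  show ?thesis
    using toep[of "diagonal_entry n A"] toep_diagonal_entry[OF A] by simp
qed

lemma toeplitz_linear_map_entry:
  assumes "toeplitz_linear_map n T" "i < n" "j < n"
  shows "toeplitz_functional n (\<lambda>A. T A $$ (i, j))"
proof -
  have "dim_row (T A) = n \<and> dim_col (T A) = n" if "A \<in> toeplitz_space n" for A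
    using assms that toeplitz_space_carrier[of "T A" n] by (auto simp: toeplitz_linear_map_def)
  then show ?thesis
    using assms by (auto simp: toeplitz_linear_map_def toeplitz_functional_def)
qed

lemma sandwich_entry:
  fixes M N :: "'a::field mat"
  assumes M: "M \<in> carrier_mat n n" and N: "N \<in> carrier_mat n n" and ij: "i < n" "j < n"
  shows "toeplitz_functional n (\<lambda>A. (M * A * N) $$ (i, j))"
proof -
  have *: "(M * (A + B) * N) $$ (i, j) = (M * A * N) $$ (i, j) + (M * B * N) $$ (i, j)"
    if "A \<in> carrier_mat n n" "B \<in> carrier_mat n n" for A B
    using M N ij that by (simp add: mult_add_distrib_mat[of _ n n] add_mult_distrib_mat[of _ n n])
  have **: "(M * (c \<cdot>\<^sub>m A) * N) $$ (i, j) = c * (M * A * N) $$ (i, j)"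
    if "A \<in> carrier_mat n n" for A c
    using M N ij that by (simp add: mult_smult_distrib[of _ n n _ n] mult_smult_assoc_mat[of _ n n _ n])
  show ?thesis
    using * ** toeplitz_space_carrier unfolding toeplitz_functional_def by blast
qed

subsection \<open>Symmetric powers\<close>

text \<open>On coefficient vectors this matrix is the substitution taking \<open>q\<close> to
  \<open>a ^ (n - 1)\<close> times \<open>q(b / a)\<close>.\<close>

definition sym_power :: "nat \<Rightarrow> 'a::field poly \<Rightarrow> 'a poly \<Rightarrow> 'a mat" where
  "sym_power n a b = mat n n (\<lambda>(i, j). coeff (a ^ (n - 1 - j) * b ^ j) i)"

lemma sym_power_carrier [simp]: "sym_power n a b \<in> carrier_mat n n"
  by (simp add: sym_power_def)

lemma degree_power_mult_le:
  fixes a b :: "'a::comm_ring_1 poly"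
  assumes "degree a \<le> 1" "degree b \<le> 1"
  shows "degree (a ^ i * b ^ j) \<le> i + j"
proof -
  have "degree (a ^ i) \<le> 1 * i" "degree (b ^ j) \<le> 1 * j"
    using assms by (meson degree_power_le le_trans mult_le_mono1)+
  then show ?thesis
    using degree_mult_le[of "a ^ i" "b ^ j"] by linarith
qed

lemma poly_eq_sum_lessThan:
  fixes q :: "'a::comm_ring_1 poly"
  assumes "degree q < n"
  shows "poly q t = (\<Sum>i<n. coeff q i * t ^ i)"
proof -
  have "poly q t = (\<Sum>i\<le>degree q. coeff q i * t ^ i)"
    by (rule poly_altdef)
  also have "\<dots> = (\<Sum>i<n. coeff q i * t ^ i)"
    using assms by (intro sum.mono_neutral_left) (auto simp: coeff_eq_0)
  finally show ?thesis .
qed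

text \<open>Multiplying the row of powers of \<open>t\<close> by the matrix evaluates at
  \<open>t\<close> the polynomials whose coefficients form its columns.\<close>

lemma sym_power_moment:
  assumes "degree a \<le> 1" "degree b \<le> 1" "j < n"
  shows "(\<Sum>i<n. sym_power n a b $$ (i, j) * t ^ i) = poly a t ^ (n - 1 - j) * poly b t ^ j"
proof -
  have "degree (a ^ (n - 1 - j) * b ^ j) < n"
    using degree_power_mult_le[OF assms(1,2), of "n - 1 - j" j] assms(3) by linarith
  then show ?thesis
    using poly_eq_sum_lessThan[of "a ^ (n - 1 - j) * b ^ j" n t] assms(3)
    by (simp add: sym_power_def)
qed

lemma flip_mat_carrier [simp]: "flip_mat n \<in> carrier_mat n n"
  by (simp add: flip_mat_def)

lemma flip_mat_mult:
  assumes "A \<in> carrier_mat n m"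
  shows "flip_mat n * A = mat n m (\<lambda>(i, j). A $$ (n - 1 - i, j))"
proof (rule eq_matI)
  fix i j assume "i < dim_row (mat n m (\<lambda>(i, j). A $$ (n - 1 - i, j)))"
    "j < dim_col (mat n m (\<lambda>(i, j). A $$ (n - 1 - i, j)))"
  then have ij: "i < n" "j < m"
    by auto
  have "(flip_mat n * A) $$ (i, j) = (\<Sum>k\<in>{0..<n}. (if i + k + 1 = n then 1 else 0) * A $$ (k, j))"
    using assms ij by (auto simp: flip_mat_def scalar_prod_def)
  also have "\<dots> = (\<Sum>k\<in>{0..<n}. if k = n - 1 - i then A $$ (k, j) else 0)"
    using ij by (intro sum.cong) auto
  finally show "(flip_mat n * A) $$ (i, j) = mat n m (\<lambda>(i, j). A $$ (n - 1 - i, j)) $$ (i, j)"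
    using ij by simp
qed (use assms in \<open>auto simp: flip_mat_def\<close>)

lemma mult_flip_mat:
  assumes "A \<in> carrier_mat m n"
  shows "A * flip_mat n = mat m n (\<lambda>(i, j). A $$ (i, n - 1 - j))"
proof (rule eq_matI)
  fix i j assume "i < dim_row (mat m n (\<lambda>(i, j). A $$ (i, n - 1 - j)))"
    "j < dim_col (mat m n (\<lambda>(i, j). A $$ (i, n - 1 - j)))"
  then have ij: "i < m" "j < n"
    by auto
  have "(A * flip_mat n) $$ (i, j) = (\<Sum>k\<in>{0..<n}. A $$ (i, k) * (if k + j + 1 = n then 1 else 0))"
    using assms ij by (auto simp: flip_mat_def scalar_prod_def)
  also have "\<dots> = (\<Sum>k\<in>{0..<n}. if k = n - 1 - j then A $$ (i, k) else 0)"
    using ij by (intro sum.cong) auto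
  finally show "(A * flip_mat n) $$ (i, j) = mat m n (\<lambda>(i, j). A $$ (i, n - 1 - j)) $$ (i, j)"
    using ij by simp
qed (use assms in \<open>auto simp: flip_mat_def\<close>)

lemma det_flip_mat: "det (flip_mat n :: 'a::field mat) \<noteq> 0"
proof -
  have "flip_mat n * flip_mat n = (1\<^sub>m n :: 'a mat)"
    by (subst flip_mat_mult) (auto simp: flip_mat_def intro!: eq_matI)
  then have "det (flip_mat n :: 'a mat) * det (flip_mat n) = 1"
    using det_mult[of "flip_mat n :: 'a mat" n "flip_mat n"] by simp
  then show ?thesis
    by auto
qed

text \<open>A kernel vector gives a polynomial \<open>q\<close> vanishing at all values of
  \<open>b / a\<close>. Independence makes \<open>b / a\<close> an injective Moebius map, so
  \<open>q\<close> has infinitely many roots.\<close>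

lemma det_sym_power:
  fixes a b :: "'a::field_char_0 poly"
  assumes deg: "degree a \<le> 1" "degree b \<le> 1"
    and ab: "coeff a 0 * coeff b 1 \<noteq> coeff a 1 * coeff b 0"
  shows "det (sym_power n a b) \<noteq> 0"
proof
  assume "det (sym_power n a b) = 0"
  then obtain v where v: "v \<in> carrier_vec n" "v \<noteq> 0\<^sub>v n" "sym_power n a b *\<^sub>v v = 0\<^sub>v n"
    using det_0_iff_vec_prod_zero_field[of "sym_power n a b" n] by auto
  have "(\<Sum>j<n. v $ j * (poly a t ^ (n - 1 - j) * poly b t ^ j)) = 0" for t
  proof -
    have "(\<Sum>j<n. v $ j * (poly a t ^ (n - 1 - j) * poly b t ^ j)) =
        (\<Sum>j<n. \<Sum>i<n. sym_power n a b $$ (i, j) * v $ j * t ^ i)"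
      by (intro sum.cong refl, subst sym_power_moment[OF deg, symmetric])
        (auto simp: sum_distrib_left mult_ac)
    also have "\<dots> = (\<Sum>i<n. (\<Sum>j<n. sym_power n a b $$ (i, j) * v $ j) * t ^ i)"
      by (subst sum.swap) (simp add: sum_distrib_right)
    also have "\<dots> = (\<Sum>i<n. (sym_power n a b *\<^sub>v v) $ i * t ^ i)"
      using v(1) by (intro sum.cong)
        (auto simp: scalar_prod_def sym_power_def lessThan_atLeast0 intro!: sum.cong)
    finally show ?thesis
      using v(3) by simp
  qed
  note zero = this
  \<comment> \<open>With these coefficients the vanishing sum above is \<open>a ^ (n - 1)\<close>
    times \<open>q(b / a)\<close>, evaluated at \<open>t\<close>.\<close>
  define q where "q = (\<Sum>j<n. monom (v $ j) j)"
  have root: "poly q (poly b t / poly a t) = 0" if t: "poly a t \<noteq> 0" for t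
  proof -
    have "poly a t ^ (n - 1) * poly q (poly b t / poly a t) =
        (\<Sum>j<n. v $ j * (poly a t ^ (n - 1 - j) * poly b t ^ j))"
      unfolding q_def poly_sum sum_distrib_left
    proof (rule sum.cong)
      fix j assume "j \<in> {..<n}"
      then have "poly a t ^ (n - 1) = poly a t ^ (n - 1 - j) * poly a t ^ j"
        by (simp flip: power_add)
      then show "poly a t ^ (n - 1) * poly (monom (v $ j) j) (poly b t / poly a t) =
          v $ j * (poly a t ^ (n - 1 - j) * poly b t ^ j)"
        using t by (simp add: poly_monom power_divide)
    qed simp
    then show ?thesis
      using zero[of t] t by simp
  qed
  have "inj_on (\<lambda>t. poly b t / poly a t) {t. poly a t \<noteq> 0}"
  proof (rule inj_onI)
    fix s t assume "s \<in> {t. poly a t \<noteq> 0}" "t \<in> {t. poly a t \<noteq> 0}"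
      and "poly b s / poly a s = poly b t / poly a t"
    then have "poly b s * poly a t = poly b t * poly a s"
      by (simp add: field_simps)
    moreover have "poly a x = coeff a 0 + coeff a 1 * x" "poly b x = coeff b 0 + coeff b 1 * x" for x
      using linear_poly_eq[OF deg(1)] linear_poly_eq[OF deg(2)]
      by (metis poly_pCons poly_0 mult_zero_right add_0_right mult.commute)+
    \<comment> \<open>After cross-multiplication everything cancels except the determinant of the
      two forms times \<open>s - t\<close>.\<close>
    ultimately have "(coeff a 0 * coeff b 1 - coeff a 1 * coeff b 0) * (s - t) = 0"
      by (simp add: algebra_simps)
    then show "s = t"
      using ab by simp
  qed
  moreover have "infinite {t. poly a t \<noteq> 0}"
  proof -
    have "a \<noteq> 0"
      using ab by auto
    then have "finite {t. poly a t = 0}"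
      by (rule poly_roots_finite)
    moreover have "{t. poly a t \<noteq> 0} = UNIV - {t. poly a t = 0}"
      by auto
    ultimately show ?thesis
      using infinite_UNIV_char_0 by (simp add: Diff_infinite_finite)
  qed
  ultimately have "infinite ((\<lambda>t. poly b t / poly a t) ` {t. poly a t \<noteq> 0})"
    using finite_image_iff by blast
  moreover have "(\<lambda>t. poly b t / poly a t) ` {t. poly a t \<noteq> 0} \<subseteq> {y. poly q y = 0}"
    using root by auto
  ultimately have "q = 0"
    using poly_roots_finite[of q] finite_subset by blast
  moreover have "coeff q j = v $ j" if "j < n" for j
    using that by (simp add: q_def coeff_sum)
  ultimately have "v $ j = 0" if "j < n" for j
    using that by (metis coeff_0)
  then show False
    using v(1,2) by (auto intro: eq_vecI)
qed

definition sandwich_left :: "nat \<Rightarrow> 'a::field mat \<Rightarrow> 'a mat" where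
  "sandwich_left n N = flip_mat n * transpose_mat N * flip_mat n"

lemma sandwich_left_carrier [simp]:
  "N \<in> carrier_mat n n \<Longrightarrow> sandwich_left n N \<in> carrier_mat n n"
  unfolding sandwich_left_def by (auto intro!: mult_carrier_mat[of _ n n _ n])

lemma sandwich_left_dim [simp]:
  "dim_row (sandwich_left n N) = n" "dim_col (sandwich_left n N) = n"
  by (simp_all add: sandwich_left_def flip_mat_def)

lemma sandwich_left_index:
  assumes "N \<in> carrier_mat n n" "i < n" "j < n"
  shows "sandwich_left n N $$ (i, j) = N $$ (n - 1 - j, n - 1 - i)"
proof -
  have "flip_mat n * transpose_mat N \<in> carrier_mat n n"
    using assms(1) by (auto intro!: mult_carrier_mat[of _ n n _ n])
  then show ?thesis
    using assms unfolding sandwich_left_def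
    by (simp add: mult_flip_mat[of _ n n] flip_mat_mult[of _ n n])
qed

lemma det_sandwich_left:
  assumes "N \<in> carrier_mat n n" "det N \<noteq> 0"
  shows "det (sandwich_left n N) \<noteq> 0"
proof -
  have "det (sandwich_left n N) = det (flip_mat n :: 'a mat) * det N * det (flip_mat n :: 'a mat)"
    using assms(1) unfolding sandwich_left_def
    by (subst det_mult[of _ n] | simp add: det_transpose mult_carrier_mat[of _ n n _ n])+
  then show ?thesis
    using assms(2) det_flip_mat[where 'a = 'a] by simp
qed

text \<open>The moment matrix is a column of powers times a row of powers. The outer factors act on
  these separately through \<open>sym_power_moment\<close>, giving the moments of the homogeneous
  point with coordinates \<open>poly a t\<close> and \<open>poly b t\<close>.\<close>

lemma sandwich_moment:
  fixes a b :: "'a::field poly"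
  assumes deg: "degree a \<le> 1" "degree b \<le> 1"
  shows "\<gamma> \<cdot>\<^sub>m sandwich_left n (sym_power n a b) * toep n (\<lambda>k. t ^ k) * sym_power n a b =
    toep n (\<lambda>k. \<gamma> * (poly a t ^ (2 * n - 2 - k) * poly b t ^ k))"
    (is "\<gamma> \<cdot>\<^sub>m ?M * ?T * ?N = ?R")
proof (rule eq_matI)
  fix i j assume "i < dim_row ?R" "j < dim_col ?R"
  then have ij: "i < n" "j < n"
    by (auto simp: toep_def)
  have M: "?M \<in> carrier_mat n n"
    by simp
  have MT: "(\<gamma> \<cdot>\<^sub>m ?M * ?T) $$ (i, k) =
      \<gamma> * (poly a t ^ i * poly b t ^ (n - 1 - i)) * t ^ k" if k: "k < n" for k
  proof -
    have "(\<gamma> \<cdot>\<^sub>m ?M * ?T) $$ (i, k) = (\<Sum>l<n. \<gamma> * ?M $$ (i, l) * ?T $$ (l, k))"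
      using ij k carrier_matD[OF M] by (auto simp: scalar_prod_def lessThan_atLeast0 toep_def intro!: sum.cong)
    also have "\<dots> = (\<Sum>l<n. \<gamma> * (?N $$ (n - 1 - l, n - 1 - i) * t ^ (n - 1 - l)) * t ^ k)"
    proof (intro sum.cong refl)
      fix l assume "l \<in> {..<n}"
      then have l: "l < n"
        by simp
      then have "?T $$ (l, k) = t ^ (n - 1 - l) * t ^ k"
        using k by (simp only: toep_index power_add)
      then show "\<gamma> * ?M $$ (i, l) * ?T $$ (l, k) =
          \<gamma> * (?N $$ (n - 1 - l, n - 1 - i) * t ^ (n - 1 - l)) * t ^ k"
        using ij l by (simp add: sandwich_left_index)
    qed
    also have "\<dots> = \<gamma> * (\<Sum>l<n. ?N $$ (n - 1 - l, n - 1 - i) * t ^ (n - 1 - l)) * t ^ k"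
      by (simp add: sum_distrib_left sum_distrib_right)
    \<comment> \<open>Reversing the summation turns the reflected entries back into column
      \<open>n - 1 - i\<close> of the symmetric power.\<close>
    also have "(\<Sum>l<n. ?N $$ (n - 1 - l, n - 1 - i) * t ^ (n - 1 - l)) =
        (\<Sum>l<n. ?N $$ (l, n - 1 - i) * t ^ l)"
      by (rule sum.reindex_bij_witness[of _ "\<lambda>l. n - 1 - l" "\<lambda>l. n - 1 - l"]) auto
    also have "\<dots> = poly a t ^ i * poly b t ^ (n - 1 - i)"
      using ij by (subst sym_power_moment[OF deg]) auto
    finally show ?thesis .
  qed
  have "(\<gamma> \<cdot>\<^sub>m ?M * ?T * ?N) $$ (i, j) = (\<Sum>k<n. (\<gamma> \<cdot>\<^sub>m ?M * ?T) $$ (i, k) * ?N $$ (k, j))"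
    using ij carrier_matD[OF M]
    by (auto simp: scalar_prod_def lessThan_atLeast0 sym_power_def toep_def intro!: sum.cong)
  also have "\<dots> = \<gamma> * (poly a t ^ i * poly b t ^ (n - 1 - i)) * (\<Sum>k<n. ?N $$ (k, j) * t ^ k)"
    using MT by (simp add: sum_distrib_left mult_ac)
  also have "\<dots> = \<gamma> * (poly a t ^ (i + (n - 1 - j)) * poly b t ^ (n - 1 - i + j))"
    unfolding sym_power_moment[OF deg ij(2)] power_add by (simp only: mult_ac)
  also have "i + (n - 1 - j) = 2 * n - 2 - (n - 1 - i + j)"
    using ij by auto
  finally show "(\<gamma> \<cdot>\<^sub>m ?M * ?T * ?N) $$ (i, j) = ?R $$ (i, j)"
    using ij by (simp add: toep_index)
qed (auto simp: toep_def sym_power_def)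

section \<open>The forms of \<open>N\<close> as symmetric powers\<close>

text \<open>The Jordan block is multiplication by a monic linear polynomial truncated below degree
  \<open>n\<close>. Truncation does no harm, since coefficients of a product depend only on
  coefficients of equal or lower degree.\<close>

lemma jordan_lower_mult_coeffs:
  fixes q :: "'a::field poly"
  shows "jordan_lower n \<alpha> *\<^sub>v vec n (coeff q) = vec n (coeff ([:\<alpha>, 1:] * q))"
proof (rule eq_vecI)
  fix i assume "i < dim_vec (vec n (coeff ([:\<alpha>, 1:] * q)))"
  then show "(jordan_lower n \<alpha> *\<^sub>v vec n (coeff q)) $ i = vec n (coeff ([:\<alpha>, 1:] * q)) $ i"
    by (subst jordan_lower_mult_vec_entry) (auto simp: coeff_pCons split: nat.splits)
qed simp

lemma jordan_lower_pow_mult_coeffs: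
  fixes q :: "'a::field poly"
  shows "jordan_lower n \<alpha> ^\<^sub>m k *\<^sub>v vec n (coeff q) = vec n (coeff ([:\<alpha>, 1:] ^ k * q))"
proof (induction k)
  case (Suc k)
  have "jordan_lower n \<alpha> ^\<^sub>m Suc k *\<^sub>v vec n (coeff q) =
      jordan_lower n \<alpha> *\<^sub>v (jordan_lower n \<alpha> ^\<^sub>m k *\<^sub>v vec n (coeff q))"
    unfolding jordan_lower_pow_Suc
    by (rule assoc_mult_mat_vec[of _ n n _ n]) (auto intro: pow_carrier_mat)
  then show ?case
    by (simp only: Suc jordan_lower_mult_coeffs power_Suc mult.assoc)
qed simp

lemma unit_vec_0_coeffs: "unit_vec n 0 = vec n (coeff (1 :: 'a::field poly))"
  by (rule eq_vecI) (auto simp: unit_vec_def coeff_pCons split: nat.splits)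

lemma V_mat_eq_sym_power:
  fixes \<alpha> :: "'a::field"
  shows "V_mat n \<alpha> = sym_power n 1 [:\<alpha>, 1:]"
proof (rule eq_matI)
  fix i j assume "i < dim_row (sym_power n 1 [:\<alpha>, 1:])" "j < dim_col (sym_power n 1 [:\<alpha>, 1:])"
  then have ij: "i < n" "j < n"
    by (auto simp: sym_power_def)
  then show "V_mat n \<alpha> $$ (i, j) = sym_power n 1 [:\<alpha>, 1:] $$ (i, j)"
    by (simp add: V_mat_def sym_power_def mat_of_cols_index unit_vec_0_coeffs
        jordan_lower_pow_mult_coeffs)
qed (auto simp: V_mat_def sym_power_def)

lemma W_mat_eq_sym_power:
  fixes \<alpha> \<beta> :: "'a::field"
  shows "W_mat n \<alpha> \<beta> = sym_power n [:\<beta>, 1:] [:\<alpha>, 1:]"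
proof (rule eq_matI)
  fix i j assume "i < dim_row (sym_power n [:\<beta>, 1:] [:\<alpha>, 1:])"
    "j < dim_col (sym_power n [:\<beta>, 1:] [:\<alpha>, 1:])"
  then have ij: "i < n" "j < n"
    by (auto simp: sym_power_def)
  have "(jordan_lower n \<beta> ^\<^sub>m k * jordan_lower n \<alpha> ^\<^sub>m l) *\<^sub>v vec n (coeff (1 :: 'a poly)) =
      vec n (coeff ([:\<beta>, 1:] ^ k * ([:\<alpha>, 1:] ^ l * 1)))" for k l
    by (subst assoc_mult_mat_vec[of _ n n _ n])
      (auto intro: pow_carrier_mat simp: jordan_lower_pow_mult_coeffs simp del: mult_1_right)
  then show "W_mat n \<alpha> \<beta> $$ (i, j) = sym_power n [:\<beta>, 1:] [:\<alpha>, 1:] $$ (i, j)"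
    using ij by (simp add: W_mat_def sym_power_def mat_of_cols_index unit_vec_0_coeffs)
qed (auto simp: W_mat_def sym_power_def)

lemma sym_power_mult_flip: "sym_power n a b * flip_mat n = sym_power n b a"
  by (subst mult_flip_mat[of _ n n])
    (auto simp: sym_power_def mult.commute intro!: eq_matI)

text \<open>Column \<open>j\<close> contains \<open>b\<close> exactly \<open>j\<close> times, so
  scaling it by \<open>r ^ j\<close> scales \<open>b\<close> by \<open>r\<close>.\<close>

lemma sym_power_mult_geom_diag: "sym_power n a b * geom_diag n r = sym_power n a (Polynomial.smult r b)"
  unfolding geom_diag_def
  by (subst mat_diag_mult_right[of _ n n])
    (auto simp: sym_power_def smult_power mult.commute intro!: eq_matI)

text \<open>The three forms of \<open>N\<close> match the three cases of \<open>normal_pair\<close>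
  in order: the flip in the second swaps the forms, and in the third \<open>a\<close> carries
  \<beta> and \<open>b\<close> carries \<alpha>.\<close>

lemma preserver_form_iff_sym_power:
  fixes T :: "'a::field mat \<Rightarrow> 'a mat"
  shows "preserver_form n T \<longleftrightarrow>
    (\<exists>\<gamma> r a b. \<gamma> \<noteq> 0 \<and> r \<noteq> 0 \<and> normal_pair a b \<and>
      (\<forall>A \<in> toeplitz_space n. T A = \<gamma> \<cdot>\<^sub>m sandwich_left n (sym_power n a (Polynomial.smult r b)) * A *
        sym_power n a (Polynomial.smult r b)))"
  unfolding preserver_form_def V_mat_eq_sym_power W_mat_eq_sym_power sym_power_mult_flip
    sym_power_mult_geom_diag sandwich_left_def[symmetric] normal_pair_def
  by (intro iffI; elim exE conjE disjE; blast)

section \<open>Toeplitz matrices of rank at most one\<close>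

lemma rank_toep_moment_le:
  fixes t :: "'a::field"
  shows "vec_space.rank n (toep n (\<lambda>k. t ^ k)) \<le> 1"
proof -
  define B where "B = mat n 1 (\<lambda>(i, _). t ^ (n - 1 - i))"
  define C where "C = mat 1 n (\<lambda>(_, j). t ^ j)"
  have "toep n (\<lambda>k. t ^ k) = B * C"
    by (rule eq_matI) (auto simp: toep_def B_def C_def scalar_prod_def power_add)
  then show ?thesis
    using vec_space.rank_mult_le[of B n 1 C n] by (simp add: B_def C_def)
qed

lemma rank_le_1_toep:
  fixes h :: "nat \<Rightarrow> 'a::field"
  assumes r: "vec_space.rank n (toep n h) \<le> 1" and l: "l + 2 < 2 * n - 1"
  shows "h l * h (l + 2) = h (l + 1) ^ 2"
proof -
  \<comment> \<open>Chooses an adjacent 2 by 2 block whose lower left corner lies on diagonal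
    \<open>l\<close>; its other corners lie on diagonals \<open>l + 1\<close> and
    \<open>l + 2\<close>.\<close>
  obtain i j where ij: "i + 1 < n" "j + 1 < n" "l = n - 2 - i + j"
  proof (cases "l < n - 1")
    case True
    then show thesis
      using l that[of "n - 2 - l" 0] by auto
  next
    case False
    then show thesis
      using l that[of 0 "l - (n - 2)"] by auto
  qed
  have idx: "n - 1 - (i + 1) + j = l" "n - 1 - i + (j + 1) = l + 2"
    "n - 1 - (i + 1) + (j + 1) = l + 1" "n - 1 - i + j = l + 1"
    using ij by auto
  have "toep n h $$ (i + 1, j) * toep n h $$ (i, j + 1) =
      toep n h $$ (i + 1, j + 1) * toep n h $$ (i, j)"
    using ij by (intro vec_space.rank_le_1_minor[OF _ r]) auto
  moreover have "i < n" "j < n"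
    using ij by auto
  ultimately show ?thesis
    using ij(1,2) by (simp only: toep_index idx power2_eq_square)
qed

section \<open>The two implications\<close>

lemma preserver_form_imp_preserves_rank:
  fixes T :: "'a::field_char_0 mat \<Rightarrow> 'a mat"
  assumes "preserver_form n T"
  shows "preserves_rank n T"
proof -
  obtain \<gamma> r a b where nz: "\<gamma> \<noteq> 0" "r \<noteq> 0" and np: "normal_pair a b"
    and T: "\<And>A. A \<in> toeplitz_space n \<Longrightarrow>
      T A = \<gamma> \<cdot>\<^sub>m sandwich_left n (sym_power n a (Polynomial.smult r b)) * A *
        sym_power n a (Polynomial.smult r b)"
    using assms unfolding preserver_form_iff_sym_power by blast
  define N where "N = sym_power n a (Polynomial.smult r b)"
  have N: "N \<in> carrier_mat n n"
    by (simp add: N_def)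
  have det: "det N \<noteq> 0"
    unfolding N_def using normal_pair_det[OF np] nz by (intro det_sym_power) auto
  have "det (\<gamma> \<cdot>\<^sub>m sandwich_left n N) \<noteq> 0"
    using det_sandwich_left[OF N det] nz by (simp add: det_smult)
  then show ?thesis
    using T N det toeplitz_space_carrier unfolding preserves_rank_def N_def[symmetric]
    by (auto intro!: vec_space.rank_mult_invertible)
qed

text \<open>The matrix represents \<open>T\<close> in diagonal coordinates; a kernel vector would be
  the diagonal sequence of a nonzero Toeplitz matrix killed by \<open>T\<close>.\<close>

lemma toeplitz_linear_map_inj_det:
  fixes T :: "'a::field mat \<Rightarrow> 'a mat"
  assumes T: "toeplitz_linear_map n T"
    and ker: "\<And>A. A \<in> toeplitz_space n \<Longrightarrow> T A = 0\<^sub>m n n \<Longrightarrow> A = 0\<^sub>m n n"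
  shows "det (mat (2 * n - 1) (2 * n - 1) (\<lambda>(l, k). diagonal_entry n (T (diagonal_unit n k)) l)) \<noteq> 0"
    (is "det ?L \<noteq> 0")
proof
  let ?m = "2 * n - 1"
  assume "det ?L = 0"
  then obtain v where v: "v \<in> carrier_vec ?m" "v \<noteq> 0\<^sub>v ?m" "?L *\<^sub>v v = 0\<^sub>v ?m"
    using det_0_iff_vec_prod_zero_field[of ?L ?m] by auto
  define h where "h k = v $ k" for k
  have TA: "T (toep n h) \<in> toeplitz_space n"
    using T unfolding toeplitz_linear_map_def by auto
  have "diagonal_entry n (T (toep n h)) l = 0" if l: "l < ?m" for l
  proof -
    have "diagonal_entry n (T (toep n h)) l = (\<Sum>k<?m. h k * diagonal_entry n (T (diagonal_unit n k)) l)"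
      unfolding diagonal_entry_def using l
      by (intro toeplitz_functional_toep toeplitz_linear_map_entry[OF T]) auto
    also have "\<dots> = (?L *\<^sub>v v) $ l"
      using l v(1) by (auto simp: h_def scalar_prod_def lessThan_atLeast0 mult.commute intro!: sum.cong)
    finally have "diagonal_entry n (T (toep n h)) l = (?L *\<^sub>v v) $ l" .
    then show ?thesis
      unfolding v(3) using l by simp
  qed
  then have "T (toep n h) = toep n (\<lambda>_. 0)"
    using toep_diagonal_entry[OF TA] toep_cong[of n "diagonal_entry n (T (toep n h))" "\<lambda>_. 0"] by simp
  also have "\<dots> = 0\<^sub>m n n"
    by (rule eq_matI) (auto simp: toep_def)
  finally have "toep n h = 0\<^sub>m n n"
    using ker by simp
  then have "h l = 0" if "l < ?m" for l
    using diagonal_entry_toep[OF that, of h] that by (simp add: diagonal_entry_def)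
  then have "v = 0\<^sub>v ?m"
    using v(1) unfolding h_def by (intro eq_vecI) auto
  then show False
    using v(2) by simp
qed

text \<open>Rank preservation enters twice: in rank zero it makes \<open>T\<close> injective, and on
  moment matrices it bounds the rank of the images by one.\<close>

lemma preserves_rank_imp_preserver_form:
  fixes T :: "'a::{field_char_0, field_gcd} mat \<Rightarrow> 'a mat"
  assumes n: "n \<ge> 1" and T: "toeplitz_linear_map n T" and rank: "preserves_rank n T"
  shows "preserver_form n T"
proof -
  define m where "m = 2 * n - 2"
  have m: "2 * n - 1 = Suc m"
    using n by (simp add: m_def)
  define E where "E l k = diagonal_entry n (T (diagonal_unit n k)) l" for l k
  \<comment> \<open>Row \<open>l\<close> of the matrix of \<open>T\<close> is read as a polynomial,
    whose value at \<open>t\<close> is diagonal \<open>l\<close> of the image of the moment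
    matrix.\<close>
  define p where "p l = (\<Sum>k\<le>m. monom (E l k) k)" for l
  have T_in: "T A \<in> toeplitz_space n" if "A \<in> toeplitz_space n" for A
    using T that unfolding toeplitz_linear_map_def by blast
  have "A = 0\<^sub>m n n" if "A \<in> toeplitz_space n" "T A = 0\<^sub>m n n" for A
    using that rank toeplitz_space_carrier vec_space.rank_eq_0_iff[of _ n n]
    unfolding preserves_rank_def by (metis zero_carrier_mat)
  then have detL: "det (mat (Suc m) (Suc m) (\<lambda>(l, k). E l k)) \<noteq> 0"
    using toeplitz_linear_map_inj_det[OF T] unfolding m E_def by blast
  define L where "L = mat (Suc m) (Suc m) (\<lambda>(l, k). E l k)"
  obtain K where K: "K \<in> carrier_mat (Suc m) (Suc m)" "K * L = 1\<^sub>m (Suc m)" "L * K = 1\<^sub>m (Suc m)"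
    using det_nonzero_inverse[of L "Suc m"] detL unfolding L_def by auto
  have coeff_p: "coeff (p l) k = E l k" if "k \<le> m" for l k
    using that by (simp add: p_def coeff_sum)
  have deg: "degree (p l) \<le> m" for l
    unfolding p_def by (intro degree_sum_le) (auto intro: order_trans[OF degree_monom_le])
  have moment: "T (toep n (\<lambda>k. t ^ k)) = toep n (\<lambda>l. poly (p l) t)" for t
  proof -
    have "diagonal_entry n (T (toep n (\<lambda>k. t ^ k))) l = poly (p l) t" if "l < 2 * n - 1" for l
    proof -
      have "diagonal_entry n (T (toep n (\<lambda>k. t ^ k))) l = (\<Sum>k<2 * n - 1. t ^ k * E l k)"
        unfolding diagonal_entry_def E_def using that
        by (intro toeplitz_functional_toep toeplitz_linear_map_entry[OF T]) auto
      also have "\<dots> = poly (p l) t"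
        unfolding m lessThan_Suc_atMost by (simp add: p_def poly_sum poly_monom mult.commute)
      finally show ?thesis .
    qed
    then show ?thesis
      using toep_diagonal_entry[OF T_in[OF toep_in_space[of n "\<lambda>k. t ^ k"]]] toep_cong by metis
  qed
  have minors: "p l * p (l + 2) = p (l + 1) ^ 2" if "l + 2 \<le> m" for l
  proof -
    have "poly (p l * p (l + 2)) t = poly (p (l + 1) ^ 2) t" for t
    proof -
      have "vec_space.rank n (toep n (\<lambda>l. poly (p l) t)) \<le> 1"
        using rank rank_toep_moment_le[of n t] unfolding preserves_rank_def
        by (metis moment toep_in_space)
      then show ?thesis
        using rank_le_1_toep[of n "\<lambda>l. poly (p l) t" l] that m by (simp add: poly_power)
    qed
    then show ?thesis
      by (intro poly_eq_poly_eq_iff[THEN iffD1] ext)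
  qed
  \<comment> \<open>A zero polynomial would be a zero row of the invertible matrix
    \<open>L\<close>.\<close>
  have nz: "p l \<noteq> 0" if "l \<le> m" for l
  proof
    assume "p l = 0"
    then have zero: "E l k = 0" if "k \<le> m" for k
      using coeff_p[OF that, of l] by simp
    have "(L * K) $$ (l, l) = (\<Sum>k<Suc m. E l k * K $$ (k, l))"
      using that K(1) by (auto simp: L_def scalar_prod_def lessThan_atLeast0 intro!: sum.cong)
    also have "\<dots> = 0"
      using zero by (intro sum.neutral) auto
    finally show False
      using K(3) that by simp
  qed
  \<comment> \<open>Since \<open>K * L\<close> is the identity, row \<open>k\<close> of
    \<open>K\<close> supplies the coefficients.\<close>
  have spanning: "\<exists>c. (\<Sum>l\<le>m. Polynomial.smult (c l) (p l)) = monom 1 k" if "k \<le> m" for k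
  proof (intro exI poly_eqI)
    fix i
    show "coeff (\<Sum>l\<le>m. Polynomial.smult (K $$ (k, l)) (p l)) i = coeff (monom 1 k) i"
    proof (cases "i \<le> m")
      case True
      have "coeff (\<Sum>l\<le>m. Polynomial.smult (K $$ (k, l)) (p l)) i = (\<Sum>l<Suc m. K $$ (k, l) * E l i)"
        by (simp add: coeff_sum coeff_p[OF True] lessThan_Suc_atMost)
      also have "\<dots> = (K * L) $$ (k, i)"
        using that True K(1)
        by (auto simp: L_def scalar_prod_def lessThan_atLeast0 intro!: sum.cong)
      finally show ?thesis
        using K(2) that True by simp
    next
      case False
      then have "coeff (p l) i = 0" for l
        using deg[of l] by (simp add: coeff_eq_0)
      then show ?thesis
        using False that by (simp add: coeff_sum)
    qed
  qed
  obtain \<gamma> r a b where gr: "\<gamma> \<noteq> 0" "r \<noteq> 0" and np: "normal_pair a b"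
    and form: "\<And>l. l \<le> m \<Longrightarrow> p l = Polynomial.smult \<gamma> (a ^ (m - l) * Polynomial.smult r b ^ l)"
    using rational_normal_curve_normal_form[of m p, OF deg nz minors spanning] by blast
  define N where "N = sym_power n a (Polynomial.smult r b)"
  define S where "S A = \<gamma> \<cdot>\<^sub>m sandwich_left n N * A * N" for A
  have deg_ab: "degree a \<le> 1" "degree (Polynomial.smult r b) \<le> 1"
    using normal_pair_det[OF np] gr(2) by auto
  \<comment> \<open>Both sides have \<open>poly (p l) t\<close> on diagonal \<open>l\<close>, by
    \<open>form\<close> and \<open>sandwich_moment\<close>.\<close>
  have agree: "T (toep n (\<lambda>k. t ^ k)) = S (toep n (\<lambda>k. t ^ k))" for t
    unfolding moment S_def N_def sandwich_moment[OF deg_ab]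
    using m by (intro toep_cong) (simp add: form m_def[symmetric] poly_power less_Suc_eq_le del: One_nat_def)
  have "T A = S A" if A: "A \<in> toeplitz_space n" for A
  proof (rule eq_matI)
    fix i j assume "i < dim_row (S A)" "j < dim_col (S A)"
    then have ij: "i < n" "j < n"
      by (auto simp: S_def N_def sym_power_def)
    have "toeplitz_functional n (\<lambda>A. S A $$ (i, j))"
      unfolding S_def using ij by (intro sandwich_entry) (auto simp: N_def)
    then show "T A $$ (i, j) = S A $$ (i, j)"
      using toeplitz_functional_eqI[OF toeplitz_linear_map_entry[OF T ij] _ _ A] agree by simp
  qed (use toeplitz_space_carrier[OF T_in[OF A]] in \<open>auto simp: S_def N_def sym_power_def\<close>)
  then show ?thesis
    using gr np unfolding preserver_form_iff_sym_power S_def N_def by blast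
qed

text \<open>The generic implications specialise to \<open>real\<close> and \<open>complex\<close>,
  both infinite fields whose polynomial rings have gcds.\<close>

theorem theorem4p2:
  fixes n :: nat
    and T\<^sub>R :: "real mat \<Rightarrow> real mat"
    and T\<^sub>C :: "complex mat \<Rightarrow> complex mat"
  assumes "n \<ge> 1"
  shows "(toeplitz_linear_map n T\<^sub>R \<longrightarrow> (preserves_rank n T\<^sub>R \<longleftrightarrow> preserver_form n T\<^sub>R)) \<and>
         (toeplitz_linear_map n T\<^sub>C \<longrightarrow> (preserves_rank n T\<^sub>C \<longleftrightarrow> preserver_form n T\<^sub>C))"
  by (intro conjI impI iffI)
    (assumption | rule preserves_rank_imp_preserver_form[OF assms] preserver_form_imp_preserves_rank)+

end
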